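(* Let $n\ge1$ and $\rho_0, \rho_1 \in [-1,1]$. For any testing scheme $(f,g,\phi)$, i.e., any functions $f,g:\mathbb{F}_2^n\to\{\pm1\}$ and $\phi:\{\pm1\}^2\to\{\mathtt{H}_0,\mathtt{H}_1\}$, $$\mathrm{P}_{\mathrm{c}}(f,g,\phi) \le \frac{1}{2} + \frac{1}{4} \max_{1\le k \le n} | \rho_0^k - \rho_1^k|.$$ Furthermore, if the maximum on the right-hand side is attained by $k=k^\star$, then equality is attained by $(f,f,\phi)$ for any level-$k^\star$ function $f$ (with $g=f$), where $\phi$ is given by: $\phi(u,v)=\mathtt{H}_0$ if $uv=1$ and $\phi(u,v)=\mathtt{H}_1$ if $uv=-1$, when $\rho_0^{k^\star}\ge\rho_1^{k^\star}$; and $\phi(u,v)=\mathtt{H}_1$ if $uv=1$ and $\phi(u,v)=\mathtt{H}_0$ if $uv=-1$, when $\rho_0^{k^\star}<\rho_1^{k^\star}$.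
   Context: $\mathbb{F}_2=\{0,1\}$, $[n]=\{1,\dots,n\}$. For $\rho\in[-1,1]$, a pair $(X^n,Y^n)$ of random vectors in $\mathbb{F}_2^n$ is called $\rho$-correlated if $X^n$ is uniform on $\mathbb{F}_2^n$ and, independently for each $i\in[n]$, $Y_i=X_i$ with probability $\frac{1+\rho}{2}$ and $Y_i=X_i+1$ with probability $\frac{1-\rho}{2}$. $\Pr_{\rho}$ denotes probability when $(X^n,Y^n)$ is $\rho$-correlated. Bayesian hypothesis testing with uniform prior: under hypothesis $\mathtt{H}_c$, $c\in\{0,1\}$, $(X^n,Y^n)$ is $\rho_c$-correlated; two encoders send the bits $f(X^n)$ and $g(Y^n)$, and the receiver decides the hypothesis by $\phi:\{\pm1\}^2\to\{\mathtt{H}_0,\mathtt{H}_1\}$. The correct probability is $$\mathrm{P}_{\mathrm{c}}(f,g,\phi) := \sum_{c\in \{0,1\}} \tfrac{1}{2} \Pr_{\rho_c}\big( \phi(f(X^n),g(Y^n)) = \mathtt{H}_c \big).$$ For $S\subset[n]$, $\chi_S(\bm{x})=(-1)^{\sum_{i\in S}x_i}$ and $\widehat{f}(S)=2^{-n}\sum_{\bm{x}\in\mathbb{F}_2^n}f(\bm{x})\chi_S(\bm{x})$. For $k\in[n]$, a level-$k$ function is a function $f:\mathbb{F}_2^n\to\{\pm1\}$ such that $\widehat{f}(S)=0$ unless $|S|=k$. *)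

theory Defs
  imports
    "HOL-Analysis.Finite_Cartesian_Product"
    "HOL-Probability.Product_PMF"
    "HOL-Library.Z2"
begin

text \<open>
  The vector space of dimension $n$ over the two-element field is \<^typ>\<open>bit ^ 'n\<close>; the finite
  index type \<open>'n\<close> plays the role of $\{1, \dots, n\}$, with $n$ = \<^term>\<open>CARD('n)\<close>.
\<close>

instance bit :: finite
proof
  have "(UNIV :: bit set) = {0, 1}"
    using bit_not_zero_iff by blast
  then show "finite (UNIV :: bit set)"
    by (metis finite.emptyI finite_insert)
qed

text \<open>
  The joint law of a $\rho$-correlated pair $(X, Y)$: \<open>keep i\<close> is the event
  $Y_i = X_i$, and these events are independent of $X$ and of each other. The law is meaningful for
  $-1 \le \rho \le 1$ only, since \<^const>\<open>bernoulli_pmf\<close> truncates its parameter to $[0, 1]$.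
\<close>

definition correlated_pmf :: "real \<Rightarrow> ((bit ^ 'n::finite) \<times> (bit ^ 'n)) pmf" where
  "correlated_pmf \<rho> =
     do {
       x \<leftarrow> pmf_of_set UNIV;
       keep \<leftarrow> Pi_pmf UNIV False (\<lambda>_. bernoulli_pmf ((1 + \<rho>) / 2));
       return_pmf (x, \<chi> i. if keep i then x $ i else x $ i + 1)
     }"

datatype hypothesis = H0 | H1

definition correct_prob ::
  "real \<Rightarrow> real \<Rightarrow> (bit ^ 'n::finite \<Rightarrow> real) \<Rightarrow> (bit ^ 'n \<Rightarrow> real) \<Rightarrow> (real \<times> real \<Rightarrow> hypothesis) \<Rightarrow> real"
where
  "correct_prob \<rho>0 \<rho>1 f g \<phi> =
     1/2 * measure_pmf.prob (correlated_pmf \<rho>0) {(x, y). \<phi> (f x, g y) = H0} +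
     1/2 * measure_pmf.prob (correlated_pmf \<rho>1) {(x, y). \<phi> (f x, g y) = H1}"

definition character :: "'n::finite set \<Rightarrow> bit ^ 'n \<Rightarrow> real" where
  "character S x = (-1) ^ (\<Sum>i\<in>S. of_bool (x $ i = 1))"

definition fourier_coeff :: "(bit ^ 'n::finite \<Rightarrow> real) \<Rightarrow> 'n set \<Rightarrow> real" where
  "fourier_coeff f S = (1 / 2 ^ CARD('n)) * (\<Sum>x\<in>UNIV. f x * character S x)"

definition level_function :: "nat \<Rightarrow> (bit ^ 'n::finite \<Rightarrow> real) \<Rightarrow> bool" where
  "level_function k f \<longleftrightarrow>
     f \<in> UNIV \<rightarrow> {-1, 1} \<and> (\<forall>S. card S \<noteq> k \<longrightarrow> fourier_coeff f S = 0)"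

end

theory Submission
  imports Defs
begin

text \<open>
  On signs \<open>u, v\<close> the indicator of \<open>\<phi> (u, v) = H0\<close> is a polynomial \<open>a + b u + c v + d u v\<close>
  with \<open>\<bar>d\<bar> \<le> 1/2\<close>. The first three terms have the same expectation under both hypotheses, since the
  marginals of a correlated pair are uniform, so only the correlation of \<open>f(X)\<close> and \<open>g(Y)\<close> matters.
  The noise acts on characters diagonally, which gives
  \<open>E f(X) g(Y) = \<Sum>\<^sub>S \<rho>^card S * fourier_coeff f S * fourier_coeff g S\<close>. The difference of these sums for
  the two correlations has no term at the empty set, and Parseval together with AM-GM bounds it by
  the maximum of \<open>\<bar>\<rho>0^k - \<rho>1^k\<bar>\<close>. For \<open>f = g\<close> of level \<open>k\<close> the difference is \<open>\<rho>0^k - \<rho>1^k\<close>.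
\<close>

section \<open>Fourier analysis on the cube: inversion and Parseval\<close>

definition bit_sign :: "bit \<Rightarrow> real" where
  "bit_sign b = (if b = 1 then -1 else 1)"

lemma bit_sign_sum:
  "1 + bit_sign a * bit_sign b = (if a = b then 2 else 0)"
  by (cases a; cases b) (auto simp: bit_sign_def)

lemma character_eq_prod:
  "character S x = (\<Prod>i\<in>S. bit_sign (x $ i))"
proof -
  have "character S x = (\<Prod>i\<in>S. (-1) ^ of_bool (x $ i = 1))"
    unfolding character_def by (rule power_sum)
  also have "\<dots> = (\<Prod>i\<in>S. bit_sign (x $ i))"
    by (rule prod.cong) (auto simp: bit_sign_def)
  finally show ?thesis .
qed

text \<open>Expanding the product of \<open>1 + bit_sign (x $ i) * bit_sign (y $ i)\<close> over all
  coordinates yields one summand per set \<open>S\<close>. Each factor is 2 or 0, so a single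
  disagreement between \<open>x\<close> and \<open>y\<close> kills the product.\<close>

lemma sum_character_mult:
  fixes x y :: "bit ^ 'n::finite"
  shows "(\<Sum>S\<in>UNIV. character S x * character S y) = (if x = y then 2 ^ CARD('n) else 0)"
proof -
  have "(\<Prod>i\<in>UNIV. bit_sign (x $ i) * bit_sign (y $ i) + 1) =
      (\<Sum>S\<in>Pow UNIV. (\<Prod>i\<in>S. bit_sign (x $ i) * bit_sign (y $ i)) * (\<Prod>i\<in>UNIV - S. 1))"
    by (rule prod_add) simp
  also have "\<dots> = (\<Sum>S\<in>UNIV. character S x * character S y)"
    by (simp add: character_eq_prod prod.distrib)
  finally have "(\<Sum>S\<in>UNIV. character S x * character S y) =
      (\<Prod>i\<in>UNIV. if x $ i = y $ i then 2 else 0)"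
    by (simp add: bit_sign_sum add.commute)
  also have "\<dots> = (if x = y then 2 ^ CARD('n) else 0)"
    by (auto simp: vec_eq_iff)
  finally show ?thesis .
qed

lemma fourier_inversion:
  fixes f :: "bit ^ 'n::finite \<Rightarrow> real"
  shows "f x = (\<Sum>S\<in>UNIV. fourier_coeff f S * character S x)"
proof -
  have "(\<Sum>S\<in>UNIV. fourier_coeff f S * character S x) =
      1 / 2 ^ CARD('n) * (\<Sum>S\<in>UNIV. \<Sum>y\<in>UNIV. f y * (character S y * character S x))"
    by (simp add: fourier_coeff_def sum_distrib_left sum_distrib_right mult_ac)
  also have "(\<Sum>S\<in>UNIV. \<Sum>y\<in>UNIV. f y * (character S y * character S x)) =
      (\<Sum>y\<in>UNIV. f y * (\<Sum>S\<in>UNIV. character S y * character S x))"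
    by (subst sum.swap) (simp add: sum_distrib_left)
  also have "\<dots> = f x * 2 ^ CARD('n)"
    by (subst sum_character_mult) (simp add: if_distrib cong: if_cong)
  finally show ?thesis by simp
qed

text \<open>Only one of the two factors in \<open>f x * f x\<close> is expanded by inversion. After
  swapping the sums, the other factor and the character rebuild the second Fourier
  coefficient.\<close>

lemma parseval:
  fixes f :: "bit ^ 'n::finite \<Rightarrow> real"
  shows "(\<Sum>S\<in>UNIV. (fourier_coeff f S)\<^sup>2) = 1 / 2 ^ CARD('n) * (\<Sum>x\<in>UNIV. (f x)\<^sup>2)"
proof -
  have "(f x)\<^sup>2 = (\<Sum>S\<in>UNIV. f x * (fourier_coeff f S * character S x))" for x
    by (simp only: power2_eq_square sum_distrib_left[symmetric] fourier_inversion[symmetric])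
  then have "(\<Sum>x\<in>UNIV. (f x)\<^sup>2) =
      (\<Sum>x\<in>UNIV. \<Sum>S\<in>UNIV. f x * (fourier_coeff f S * character S x))"
    by (simp only:)
  also have "\<dots> = (\<Sum>S\<in>UNIV. fourier_coeff f S * (\<Sum>x\<in>UNIV. f x * character S x))"
    by (subst sum.swap) (simp add: sum_distrib_left mult_ac)
  finally have "1 / 2 ^ CARD('n) * (\<Sum>x\<in>UNIV. (f x)\<^sup>2) = (\<Sum>S\<in>UNIV.
      fourier_coeff f S * (1 / 2 ^ CARD('n) * (\<Sum>x\<in>UNIV. f x * character S x)))"
    by (simp only:) (subst sum_distrib_left, simp only: mult.left_commute)
  then show ?thesis
    by (simp only: fourier_coeff_def[symmetric] power2_eq_square)
qed

lemma card_bit: "CARD(bit) = 2"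
proof -
  have "(UNIV :: bit set) = {0, 1}"
    using bit_not_zero_iff by blast
  then have "CARD(bit) = card {0 :: bit, 1}"
    by (rule arg_cong)
  then show ?thesis
    by simp
qed

lemma sum_fourier_coeff_power2:
  fixes f :: "bit ^ 'n::finite \<Rightarrow> real"
  assumes "f \<in> UNIV \<rightarrow> {-1, 1}"
  shows "(\<Sum>S\<in>UNIV. (fourier_coeff f S)\<^sup>2) = 1"
proof -
  have "(f x)\<^sup>2 = 1" for x
    using assms by (auto simp: Pi_iff power2_eq_1_iff)
  then show ?thesis
    by (simp add: parseval card_bit)
qed

text \<open>The coefficient at the empty set already exhausts the Parseval total 1, so nothing is
  left for any other set. This later turns the marginal expectations into instances of the
  correlation formula.\<close>

lemma fourier_coeff_const_one:
  fixes S :: "'n::finite set"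
  shows "fourier_coeff (\<lambda>_. 1) S = of_bool (S = {})"
proof (cases "S = {}")
  case True
  then show ?thesis
    by (simp add: fourier_coeff_def character_def card_bit)
next
  case False
  have empty: "fourier_coeff (\<lambda>_. 1) ({} :: 'n set) = 1"
    by (simp add: fourier_coeff_def character_def card_bit)
  have "(\<Sum>T\<in>{{}, S}. (fourier_coeff (\<lambda>_. 1) T)\<^sup>2) \<le>
      (\<Sum>T\<in>(UNIV :: 'n set set). (fourier_coeff (\<lambda>_. 1) T)\<^sup>2)"
    by (rule sum_mono2) auto
  also have "\<dots> = 1"
    by (rule sum_fourier_coeff_power2) simp
  finally have "(fourier_coeff (\<lambda>_. 1) S)\<^sup>2 \<le> 0"
    using False empty by simp
  then show ?thesis
    using False by simp
qed

section \<open>The noise acting on characters\<close>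

lemma expectation_character_flip:
  fixes x :: "bit ^ 'n::finite"
  assumes "\<rho> \<in> {-1..1}"
  shows "measure_pmf.expectation (Pi_pmf UNIV False (\<lambda>_. bernoulli_pmf ((1 + \<rho>) / 2)))
      (\<lambda>keep. character S (\<chi> i. if keep i then x $ i else x $ i + 1)) = \<rho> ^ card S * character S x"
    (is "measure_pmf.expectation ?K _ = _")
proof -
  let ?p = "(1 + \<rho>) / 2"
  \<comment> \<open>\<open>s i b\<close> is the sign by which coordinate \<open>i\<close> changes
    the character. Its value 1 outside \<open>S\<close> lets the product run over all coordinates,
    as the product law of \<open>keep\<close> does.\<close>
  define s where "s = (\<lambda>i b. if i \<in> S \<and> \<not> b then -1 else (1 :: real))"
  have flip: "character S (\<chi> i. if keep i then x $ i else x $ i + 1) =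
      character S x * (\<Prod>i\<in>UNIV. s i (keep i))" for keep
  proof -
    have "(\<Prod>i\<in>UNIV. s i (keep i)) = (\<Prod>i\<in>S. s i (keep i))"
      by (rule prod.mono_neutral_right) (auto simp: s_def)
    moreover have "bit_sign (if keep i then x $ i else x $ i + 1) = bit_sign (x $ i) * s i (keep i)"
      if "i \<in> S" for i
      using that by (cases "x $ i") (auto simp: s_def bit_sign_def)
    ultimately show ?thesis
      by (simp add: character_eq_prod prod.distrib)
  qed
  have "measure_pmf.expectation ?K (\<lambda>keep. \<Prod>i\<in>UNIV. s i (keep i)) =
      (\<Sum>keep\<in>UNIV. pmf ?K keep * (\<Prod>i\<in>UNIV. s i (keep i)))"
    by (subst integral_measure_pmf[of UNIV]) auto
  \<comment> \<open>Independence factors the probability of \<open>keep\<close>; writing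
    \<open>UNIV\<close> as a \<open>PiE\<close> set prepares the exchange of sum and
    product.\<close>
  also have "\<dots> = (\<Sum>keep\<in>PiE UNIV (\<lambda>_. UNIV).
      \<Prod>i\<in>UNIV. pmf (bernoulli_pmf ?p) (keep i) * s i (keep i))"
    by (simp add: pmf_Pi prod.distrib PiE_UNIV_domain)
  also have "\<dots> = (\<Prod>i\<in>UNIV. \<Sum>b\<in>UNIV. pmf (bernoulli_pmf ?p) b * s i b)"
    by (rule prod_sum_PiE[symmetric]) auto
  \<comment> \<open>For \<open>i\<close> in \<open>S\<close> the sum is (1 + \<rho>)/2 - (1 -
    \<rho>)/2 = \<rho>, otherwise the probabilities add up to 1. The range of \<rho> ensures that
    \<open>bernoulli_pmf\<close> does not truncate its parameter.\<close>
  also have "\<dots> = (\<Prod>i\<in>UNIV. if i \<in> S then \<rho> else 1)"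
    using assms by (intro prod.cong) (auto simp: UNIV_bool s_def field_simps)
  also have "\<dots> = \<rho> ^ card S"
    by (simp add: prod.If_cases)
  finally show ?thesis
    by (simp add: flip)
qed

text \<open>Given X = x, expanding \<open>g\<close> in characters multiplies each coefficient by
  \<open>\<rho> ^ card S\<close>. Averaging \<open>f x * character S x\<close> over the uniform
  \<open>x\<close> then produces the coefficient of \<open>f\<close>.\<close>

lemma expectation_correlated_pmf:
  fixes f g :: "bit ^ 'n::finite \<Rightarrow> real"
  assumes "\<rho> \<in> {-1..1}"
  shows "measure_pmf.expectation (correlated_pmf \<rho>) (\<lambda>(x, y). f x * g y) =
      (\<Sum>S\<in>UNIV. \<rho> ^ card S * (fourier_coeff f S * fourier_coeff g S))"
proof -
  let ?K = "Pi_pmf UNIV False (\<lambda>_. bernoulli_pmf ((1 + \<rho>) / 2)) :: ('n \<Rightarrow> bool) pmf"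
  let ?y = "\<lambda>x keep. (\<chi> i. if keep i then x $ i else x $ i + 1) :: bit ^ 'n"
  have integrable: "integrable ?K h" for h :: "('n \<Rightarrow> bool) \<Rightarrow> real"
    by (rule integrable_measure_pmf_finite) simp
  have noise: "measure_pmf.expectation ?K (\<lambda>keep. g (?y x keep)) =
      (\<Sum>S\<in>UNIV. fourier_coeff g S * (\<rho> ^ card S * character S x))" for x
  proof -
    have "measure_pmf.expectation ?K (\<lambda>keep. g (?y x keep)) = measure_pmf.expectation ?K
        (\<lambda>keep. \<Sum>S\<in>UNIV. fourier_coeff g S * character S (?y x keep))"
      by (simp only: fourier_inversion[symmetric])
    also have "\<dots> = (\<Sum>S\<in>UNIV. fourier_coeff g S *
        measure_pmf.expectation ?K (\<lambda>keep. character S (?y x keep)))"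
      by (subst Bochner_Integration.integral_sum) (auto intro: integrable)
    finally show ?thesis
      by (simp only: expectation_character_flip[OF assms])
  qed
  have "correlated_pmf \<rho> = pmf_of_set UNIV \<bind> (\<lambda>x. map_pmf (\<lambda>keep. (x, ?y x keep)) ?K)"
    by (simp add: correlated_pmf_def map_pmf_def)
  then have "measure_pmf.expectation (correlated_pmf \<rho>) (\<lambda>(x, y). f x * g y) =
      (\<Sum>x\<in>UNIV. measure_pmf.expectation (map_pmf (\<lambda>keep. (x, ?y x keep)) ?K) (\<lambda>(x, y). f x * g y)
        /\<^sub>R real CARD(bit ^ 'n))"
    by (simp only:) (rule pmf_expectation_bind_pmf_of_set, simp_all)
  also have "\<dots> =
      (\<Sum>x\<in>UNIV. f x * measure_pmf.expectation ?K (\<lambda>keep. g (?y x keep)) / 2 ^ CARD('n))"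
    by (simp only: integral_map_pmf prod.case integral_mult_right_zero CARD_vec card_bit
        real_scaleR_def of_nat_power of_nat_numeral divide_inverse mult.commute)
  also have "\<dots> = (\<Sum>x\<in>UNIV. \<Sum>S\<in>UNIV.
      \<rho> ^ card S * (f x * character S x / 2 ^ CARD('n) * fourier_coeff g S))"
    by (simp only: noise sum_distrib_left sum_divide_distrib)
       (simp add: mult_ac)
  also have "\<dots> = (\<Sum>S\<in>UNIV. \<rho> ^ card S * (fourier_coeff f S * fourier_coeff g S))"
    by (subst sum.swap)
       (simp add: fourier_coeff_def[of f] sum_distrib_left sum_distrib_right mult_ac)
  finally show ?thesis .
qed

section \<open>The correct probability in Fourier terms, its bound, and equality\<close>

lemma correct_prob_eq:
  fixes f g :: "bit ^ 'n::finite \<Rightarrow> real" and \<phi> :: "real \<times> real \<Rightarrow> hypothesis"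
  defines "h \<equiv> \<lambda>u v. of_bool (\<phi> (u, v) = H0) :: real"
  assumes \<rho>: "\<rho>0 \<in> {-1..1}" "\<rho>1 \<in> {-1..1}"
    and f: "f \<in> UNIV \<rightarrow> {-1, 1}" and g: "g \<in> UNIV \<rightarrow> {-1, 1}"
  shows "correct_prob \<rho>0 \<rho>1 f g \<phi> = 1/2 + (h 1 1 - h 1 (-1) - h (-1) 1 + h (-1) (-1)) / 8 *
      (\<Sum>S\<in>UNIV. (\<rho>0 ^ card S - \<rho>1 ^ card S) * (fourier_coeff f S * fourier_coeff g S))"
proof -
  \<comment> \<open>These are the Fourier coefficients of \<open>h\<close> as a function of two
    signs, hence the unique interpolating polynomial that is linear in each variable.\<close>
  define a b c d where
    "a = (h 1 1 + h 1 (-1) + h (-1) 1 + h (-1) (-1)) / 4" and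
    "b = (h 1 1 + h 1 (-1) - h (-1) 1 - h (-1) (-1)) / 4" and
    "c = (h 1 1 - h 1 (-1) + h (-1) 1 - h (-1) (-1)) / 4" and
    "d = (h 1 1 - h 1 (-1) - h (-1) 1 + h (-1) (-1)) / 4"
  let ?A = "{(x, y). \<phi> (f x, g y) = H0}"
  have expand: "indicator ?A (x, y) = a + b * f x + c * g y + d * (f x * g y)" for x y
  proof -
    have "f x = 1 \<or> f x = -1" "g y = 1 \<or> g y = -1"
      using f g by auto
    then show ?thesis
      by (auto simp: a_def b_def c_def d_def h_def indicator_def)
  qed
  have prob: "measure_pmf.prob (correlated_pmf \<rho>) ?A = a + b * fourier_coeff f {} + c * fourier_coeff g {}
      + d * (\<Sum>S\<in>UNIV. \<rho> ^ card S * (fourier_coeff f S * fourier_coeff g S))"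
    if "\<rho> \<in> {-1..1}" for \<rho>
  proof -
    let ?E = "measure_pmf.expectation (correlated_pmf \<rho> :: ((bit ^ 'n) \<times> (bit ^ 'n)) pmf)"
    have integrable: "integrable (correlated_pmf \<rho>) k" for k :: "(bit ^ 'n) \<times> (bit ^ 'n) \<Rightarrow> real"
      by (rule integrable_measure_pmf_finite) simp
    have "measure_pmf.prob (correlated_pmf \<rho>) ?A = ?E (indicator ?A)"
      by simp
    \<comment> \<open>The explicit factors 1 make the marginals correlations with a constant
      function. Only the empty set then survives in their Fourier sums, where \<rho> enters as its
      zeroth power.\<close>
    also have "\<dots> = ?E (\<lambda>z. a + b * (case z of (x, y) \<Rightarrow> f x * 1) + c * (case z of (x, y) \<Rightarrow> 1 * g y)
        + d * (case z of (x, y) \<Rightarrow> f x * g y))"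
      by (rule Bochner_Integration.integral_cong) (auto simp: expand)
    also have "\<dots> = a + b * ?E (\<lambda>(x, y). f x * 1) + c * ?E (\<lambda>(x, y). 1 * g y)
        + d * ?E (\<lambda>(x, y). f x * g y)"
      by (simp only: Bochner_Integration.integral_add integral_mult_right_zero integrable) simp
    finally show ?thesis
      by (simp only: expectation_correlated_pmf[OF that] fourier_coeff_const_one)
         (simp add: of_bool_def mult_delta_left mult_delta_right)
  qed
  have "v = H1 \<longleftrightarrow> v \<noteq> H0" for v
    by (cases v) auto
  then have "{(x, y). \<phi> (f x, g y) = H1} = - ?A"
    by auto
  then have "measure_pmf.prob (correlated_pmf \<rho>1) {(x, y). \<phi> (f x, g y) = H1} =
      1 - measure_pmf.prob (correlated_pmf \<rho>1) ?A"
    by (simp add: measure_pmf.prob_compl[symmetric] Compl_eq_Diff_UNIV)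
  \<comment> \<open>The terms with \<open>a\<close>, \<open>b\<close> and \<open>c\<close> do not
    depend on the hypothesis and cancel; the 1/2 comes from the complement under
    \<open>\<rho>1\<close>.\<close>
  then have "correct_prob \<rho>0 \<rho>1 f g \<phi> = 1/2 + d / 2 *
      ((\<Sum>S\<in>UNIV. \<rho>0 ^ card S * (fourier_coeff f S * fourier_coeff g S)) -
       (\<Sum>S\<in>UNIV. \<rho>1 ^ card S * (fourier_coeff f S * fourier_coeff g S)))"
    using \<rho> by (simp add: correct_prob_def prob algebra_simps add_divide_distrib diff_divide_distrib)
  then show ?thesis
    by (simp add: sum_subtractf[symmetric] left_diff_distrib d_def)
qed

lemma correct_prob_le:
  fixes f g :: "bit ^ 'n::finite \<Rightarrow> real" and \<phi> :: "real \<times> real \<Rightarrow> hypothesis"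
  assumes \<rho>: "\<rho>0 \<in> {-1..1}" "\<rho>1 \<in> {-1..1}"
    and f: "f \<in> UNIV \<rightarrow> {-1, 1}" and g: "g \<in> UNIV \<rightarrow> {-1, 1}"
  shows "correct_prob \<rho>0 \<rho>1 f g \<phi> \<le> 1/2 + 1/4 * (MAX k\<in>{1..CARD('n)}. \<bar>\<rho>0 ^ k - \<rho>1 ^ k\<bar>)"
proof -
  define M where "M = (MAX k\<in>{1..CARD('n)}. \<bar>\<rho>0 ^ k - \<rho>1 ^ k\<bar>)"
  define h where "h = (\<lambda>u v. of_bool (\<phi> (u, v) = H0) :: real)"
  define F where
    "F = (\<Sum>S\<in>UNIV. (\<rho>0 ^ card S - \<rho>1 ^ card S) * (fourier_coeff f S * fourier_coeff g S))"
  define D where "D = h 1 1 - h 1 (-1) - h (-1) 1 + h (-1) (-1)"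
  have le_M: "\<bar>\<rho>0 ^ k - \<rho>1 ^ k\<bar> \<le> M" if "k \<in> {1..CARD('n)}" for k
    unfolding M_def using that by (intro Max_ge) auto
  \<comment> \<open>The index 1 is available because an index type is never empty.\<close>
  have "0 \<le> M"
    using le_M[of 1] by (simp add: Suc_le_eq)
  have term_le: "\<bar>(\<rho>0 ^ card S - \<rho>1 ^ card S) * (fourier_coeff f S * fourier_coeff g S)\<bar> \<le>
      M * (((fourier_coeff f S)\<^sup>2 + (fourier_coeff g S)\<^sup>2) / 2)" for S :: "'n set"
  proof -
    have "\<bar>\<rho>0 ^ card S - \<rho>1 ^ card S\<bar> \<le> M"
    \<comment> \<open>Level 0 lies outside the range of the maximum, but there the two powers are
      equal.\<close>
    proof (cases "S = {}")
      case True
      then show ?thesis using \<open>0 \<le> M\<close> by simp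
    next
      case False
      then show ?thesis
        by (intro le_M) (auto simp: Suc_le_eq card_gt_0_iff intro: card_mono)
    qed
    moreover have "\<bar>fourier_coeff f S * fourier_coeff g S\<bar> \<le>
        ((fourier_coeff f S)\<^sup>2 + (fourier_coeff g S)\<^sup>2) / 2"
      using sum_squares_bound[of "\<bar>fourier_coeff f S\<bar>" "\<bar>fourier_coeff g S\<bar>"]
      by (simp add: abs_mult)
    ultimately show ?thesis
      unfolding abs_mult[of "\<rho>0 ^ card S - \<rho>1 ^ card S"] using \<open>0 \<le> M\<close> by (intro mult_mono) auto
  qed
  have "\<bar>F\<bar> \<le> (\<Sum>S\<in>UNIV. M * (((fourier_coeff f S)\<^sup>2 + (fourier_coeff g S)\<^sup>2) / 2))"
    unfolding F_def by (rule order_trans[OF sum_abs sum_mono]) (rule term_le)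
  also have "\<dots> = M"
    using sum_fourier_coeff_power2[OF f] sum_fourier_coeff_power2[OF g]
    by (simp add: sum_distrib_left[symmetric] sum_divide_distrib[symmetric] sum.distrib)
  finally have "\<bar>F\<bar> \<le> M" .
  \<comment> \<open>Two of the four 0/1 values enter with each sign. With the factor 1/8 this bound
    gives the constant 1/4.\<close>
  moreover have "\<bar>D\<bar> \<le> 2"
    by (auto simp: D_def h_def of_bool_def)
  ultimately have "\<bar>D * F\<bar> \<le> 2 * M"
    unfolding abs_mult by (intro mult_mono) auto
  moreover have "correct_prob \<rho>0 \<rho>1 f g \<phi> = 1/2 + D / 8 * F"
    unfolding D_def F_def h_def by (rule correct_prob_eq[OF \<rho> f g])
  ultimately show ?thesis
    unfolding M_def by simp
qed

text \<open>All Fourier mass of \<open>f\<close> sits on level \<open>k\<close>, so the sum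
  collapses to the difference of the powers times the Parseval total 1. The decision rule makes the
  coefficient of \<open>correct_prob_eq\<close> 2/8 or -2/8 with the sign of that difference, which
  creates the absolute value.\<close>

lemma correct_prob_level_function:
  fixes f :: "bit ^ 'n::finite \<Rightarrow> real" and \<phi> :: "real \<times> real \<Rightarrow> hypothesis"
  assumes \<rho>: "\<rho>0 \<in> {-1..1}" "\<rho>1 \<in> {-1..1}"
    and level: "level_function k f"
    and \<phi>: "\<forall>u\<in>{-1, 1}. \<forall>v\<in>{-1, 1}. \<phi> (u, v) =
      (if \<rho>0 ^ k \<ge> \<rho>1 ^ k then (if u * v = 1 then H0 else H1) else (if u * v = 1 then H1 else H0))"
  shows "correct_prob \<rho>0 \<rho>1 f f \<phi> = 1/2 + 1/4 * \<bar>\<rho>0 ^ k - \<rho>1 ^ k\<bar>"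
proof -
  have f: "f \<in> UNIV \<rightarrow> {-1, 1}" and zero: "\<And>S. card S \<noteq> k \<Longrightarrow> fourier_coeff f S = 0"
    using level by (auto simp: level_function_def)
  have "(\<Sum>S\<in>UNIV. (\<rho>0 ^ card S - \<rho>1 ^ card S) * (fourier_coeff f S * fourier_coeff f S)) =
      (\<Sum>S\<in>UNIV. (\<rho>0 ^ k - \<rho>1 ^ k) * (fourier_coeff f S)\<^sup>2)"
  proof (rule sum.cong)
    fix S :: "'n set"
    show "(\<rho>0 ^ card S - \<rho>1 ^ card S) * (fourier_coeff f S * fourier_coeff f S) =
        (\<rho>0 ^ k - \<rho>1 ^ k) * (fourier_coeff f S)\<^sup>2"
      using zero[of S] by (cases "card S = k") (auto simp: power2_eq_square)
  qed simp
  also have "\<dots> = \<rho>0 ^ k - \<rho>1 ^ k"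
    by (simp add: sum_distrib_left[symmetric] sum_fourier_coeff_power2[OF f])
  finally show ?thesis
    using \<phi> by (simp add: correct_prob_eq[OF \<rho> f f])
qed

theorem theorem6:
  fixes \<rho>0 \<rho>1 :: real
  assumes "\<rho>0 \<in> {-1..1}" and "\<rho>1 \<in> {-1..1}"
  shows
    "(\<forall>(f :: bit ^ 'n::finite \<Rightarrow> real) (g :: bit ^ 'n \<Rightarrow> real) (\<phi> :: real \<times> real \<Rightarrow> hypothesis).
        f \<in> UNIV \<rightarrow> {-1, 1} \<longrightarrow> g \<in> UNIV \<rightarrow> {-1, 1} \<longrightarrow>
        correct_prob \<rho>0 \<rho>1 f g \<phi>
          \<le> 1/2 + 1/4 * (MAX k\<in>{1..CARD('n)}. \<bar>\<rho>0 ^ k - \<rho>1 ^ k\<bar>)) \<and>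
     (\<forall>k\<in>{1..CARD('n)}.
        \<bar>\<rho>0 ^ k - \<rho>1 ^ k\<bar> = (MAX j\<in>{1..CARD('n)}. \<bar>\<rho>0 ^ j - \<rho>1 ^ j\<bar>) \<longrightarrow>
        (\<forall>(f :: bit ^ 'n \<Rightarrow> real) (\<phi> :: real \<times> real \<Rightarrow> hypothesis).
           level_function k f \<longrightarrow>
           (\<forall>u\<in>{-1, 1}. \<forall>v\<in>{-1, 1}.
              \<phi> (u, v) =
                (if \<rho>0 ^ k \<ge> \<rho>1 ^ k
                 then (if u * v = 1 then H0 else H1)
                 else (if u * v = 1 then H1 else H0))) \<longrightarrow>
           correct_prob \<rho>0 \<rho>1 f f \<phi>
             = 1/2 + 1/4 * (MAX j\<in>{1..CARD('n)}. \<bar>\<rho>0 ^ j - \<rho>1 ^ j\<bar>)))"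
proof (intro conjI allI impI ballI, goal_cases)
  case (1 f g \<phi>)
  then show ?case
    by (rule correct_prob_le[OF assms])
next
  case (2 k f \<phi>)
  show ?case
    using correct_prob_level_function[OF assms 2(3,4)] by (simp only: 2(2))
qed

end
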